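(* Let $A$ be a finite subset of $\mathbb{Z}_{>0}$. For all $\pi\in\Pi_{\Gamma_A}$, $$(-1)^{|\pi|}\mu_{\Pi_{\Gamma_A}}(\hat0,\pi)=\left|\{\sigma\in\mathcal{D}_A : \mathrm{cyc}(\sigma)=\pi\}\right|.$$ Consequently, $$\chi_{\Pi_{\Gamma_A}}(t)=\sum_{k=1}^{|A|}s_D(A,k)\,t^{k-1},$$ where $(-1)^{k}s_D(A,k)$ is equal to the number of D-permutations on $A$ with exactly $k$ cycles.
   Context: For a finite set $A\subset\mathbb{Z}_{>0}$, $\Gamma_A$ is the bipartite graph on vertex set $A$ with an edge $\{u,v\}$ for each $u<v$ in $A$ with $u$ odd and $v$ even. For a finite graph $G$ with vertex set $V$, the bond lattice $\Pi_G$ is the set of partitions $\pi$ of $V$ such that the induced subgraph of $G$ on each block is connected, ordered by: $\pi\le\pi'$ iff every block of $\pi$ is contained in a block of $\pi'$. Its minimum $\hat0$ is the partition into singletons, and $|\pi|$ denotes the number of blocks of $\pi$. For a finite ranked poset $P$ of length $\ell$ with minimum $\hat0$, Möbius function $\mu_P$ and rank function $\mathrm{rk}$, the characteristic polynomial is $\chi_P(t)=\sum_{x\in P}\mu_P(\hat0,x)t^{\ell-\mathrm{rk}(x)}$. A permutation $\sigma$ of $A$ is a D-permutation on $A$ if $i\le\sigma(i)$ whenever $i\in A$ is odd and $i\ge\sigma(i)$ whenever $i\in A$ is even; $\mathcal{D}_A$ is the set of D-permutations on $A$. The cycle support $\mathrm{cyc}(\sigma)$ is the partition of $A$ whose blocks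 are the sets of elements of the cycles of $\sigma$. Fixed points count as cycles and give singleton blocks.
   Formalization: As printed false (A={1}: -1≠1). Proved for all A with factor (-1)^{|A|} on the right of both identities, and exponent k-c, sum from k=c (c = number of components of Γ_A), in the second; the printed forms are proved when |A| is even (second: and Γ_A connected). *)

theory Defs
  imports
    "HOL-Library.Disjoint_Sets"
    "HOL-Combinatorics.Permutations"
    "HOL-Combinatorics.Orbits"
    "HOL-Computational_Algebra.Polynomial"
    "Graph_Theory.Digraph_Component"
begin

section \<open>Finite posets\<close>

text \<open>
  A poset is given by its order relation r, whose underlying set is Field r.
  A chain with m elements has length m - 1, and the rank of x is the length of the
  principal ideal below x.
\<close>

definition poset_length :: "'a rel \<Rightarrow> nat" where
  "poset_length r = Max (card ` Chains r) - 1"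

definition poset_rank :: "'a rel \<Rightarrow> 'a \<Rightarrow> nat" where
  "poset_rank r x = poset_length (Restr r (under r x))"

definition poset_bot :: "'a rel \<Rightarrow> 'a" where
  "poset_bot r = (THE z. z \<in> Field r \<and> (\<forall>y \<in> Field r. (z, y) \<in> r))"

text \<open>
  The guard only serves to make the recursion total: outside finite posets, and for
  pairs that are not related, the value is 0.
\<close>

function mobius :: "'a rel \<Rightarrow> 'a \<Rightarrow> 'a \<Rightarrow> int" where
  "mobius r x y =
     (if finite (Field r) \<and> Partial_order r \<and> (x, y) \<in> r
      then (if x = y then 1
            else - (\<Sum>z \<in> {z. (x, z) \<in> r \<and> (z, y) \<in> r \<and> z \<noteq> y}. mobius r x z))
      else 0)"
  by pat_completeness auto
termination
proof (relation "Wellfounded.measure (\<lambda>(r, x, y). card {z. (x, z) \<in> r \<and> (z, y) \<in> r})", goal_cases)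
  case 1
  show ?case by simp
next
  case (2 r x y z)
  then have fin: "finite (Field r)" and tr: "trans r" and asym: "antisym r" and rf: "refl_on (Field r) r"
    and xy: "(x, y) \<in> r" and z: "(x, z) \<in> r" "(z, y) \<in> r" "z \<noteq> y"
    by (auto simp: partial_order_on_def preorder_on_def)
  have yy: "(y, y) \<in> r"
    using rf xy by (meson FieldI2 refl_onD)
  have "{w. (x, w) \<in> r \<and> (w, z) \<in> r} \<subseteq> {w. (x, w) \<in> r \<and> (w, y) \<in> r}"
    using tr z by (auto dest: transD)
  moreover have "y \<notin> {w. (x, w) \<in> r \<and> (w, z) \<in> r}"
    using asym z by (auto dest: antisymD)
  ultimately have "{w. (x, w) \<in> r \<and> (w, z) \<in> r} \<subset> {w. (x, w) \<in> r \<and> (w, y) \<in> r}"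
    using xy yy by blast
  moreover have "finite {w. (x, w) \<in> r \<and> (w, y) \<in> r}"
    by (rule finite_subset[OF _ fin]) (auto intro: FieldI2)
  ultimately show ?case
    by (simp add: psubset_card_mono)
qed

declare mobius.simps [simp del]

definition characteristic_poly :: "'a rel \<Rightarrow> int poly" where
  "characteristic_poly r =
     (\<Sum>x \<in> Field r. monom (mobius r (poset_bot r) x) (poset_length r - poset_rank r x))"


section \<open>Bond lattices\<close>

text \<open>Undirected graphs are represented as symmetric digraphs.\<close>

definition bond_partitions :: "('a, 'b) pre_digraph \<Rightarrow> 'a set set set" where
  "bond_partitions G =
     {\<pi>. partition_on (verts G) \<pi> \<and> (\<forall>B \<in> \<pi>. Digraph_Component.connected (G \<restriction> B))}"

definition bond_lattice :: "('a, 'b) pre_digraph \<Rightarrow> 'a set set rel" where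
  "bond_lattice G =
     {(\<pi>, \<pi>'). \<pi> \<in> bond_partitions G \<and> \<pi>' \<in> bond_partitions G \<and> refines (verts G) \<pi> \<pi>'}"

definition singletons :: "'a set \<Rightarrow> 'a set set" where
  "singletons V = (\<lambda>v. {v}) ` V"

text \<open>Strong components of the underlying symmetric graph are its connected components.\<close>

definition num_components :: "('a, 'b) pre_digraph \<Rightarrow> nat" where
  "num_components G = card (pre_digraph.sccs (with_proj (mk_symmetric G)))"


section \<open>The graph of a set of positive integers, and D-permutations\<close>

definition Gamma_pair :: "nat set \<Rightarrow> nat pair_pre_digraph" where
  "Gamma_pair A =
     \<lparr> pverts = A,
       parcs = {(u, v). u \<in> A \<and> v \<in> A \<and> u < v \<and> odd u \<and> even v} \<union>
               {(v, u). u \<in> A \<and> v \<in> A \<and> u < v \<and> odd u \<and> even v} \<rparr>"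

abbreviation Gamma :: "nat set \<Rightarrow> (nat, nat \<times> nat) pre_digraph" where
  "Gamma A \<equiv> with_proj (Gamma_pair A)"

definition D_perms :: "nat set \<Rightarrow> (nat \<Rightarrow> nat) set" where
  "D_perms A =
     {\<sigma>. \<sigma> permutes A \<and> (\<forall>i \<in> A. odd i \<longrightarrow> i \<le> \<sigma> i) \<and> (\<forall>i \<in> A. even i \<longrightarrow> \<sigma> i \<le> i)}"

definition cycle_support :: "'a set \<Rightarrow> ('a \<Rightarrow> 'a) \<Rightarrow> 'a set set" where
  "cycle_support A \<sigma> = orbit \<sigma> ` A"

definition s_D :: "nat set \<Rightarrow> nat \<Rightarrow> int" where
  "s_D A k = (- 1) ^ k * int (card {\<sigma> \<in> D_perms A. card (cycle_support A \<sigma>) = k})"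

end

theory Submission
  imports Defs
begin

text \<open>
  The sum of the signs of the D-permutations whose cycle support refines a bond partition
  is 1 for the partition into singletons. For any other bond partition it vanishes: a connected
  set with at least two vertices has an odd minimum a and an even maximum b, and composing
  with the transposition of a and b is a sign-reversing involution. (Equivalently, the rows of
  a and b in the 0-1 matrix of admissible values coincide, so its determinant is 0.) Hence
  the recursion that defines the Moebius function is solved by the sum of the signs of the
  D-permutations with a given cycle support, and all of these signs are equal to
  \<open>(-1) ^ (|A| - |\<pi>|)\<close>. The characteristic polynomial follows because the rank of
  \<open>\<pi>\<close> is \<open>|A| - |\<pi>|\<close>.
\<close>

lemma partition_on_unique:
  assumes "partition_on A P" "p \<in> P" "q \<in> P" "x \<in> p" "x \<in> q"
  shows "p = q"
  using assms disjointD[OF partition_onD2] by fastforce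


section \<open>Signs and cycles\<close>

text \<open>The composite cuts \<open>a\<close> out of its cycle: it fixes \<open>a\<close> and
  sends the predecessor of \<open>a\<close> straight to \<open>\<sigma> a\<close>. This shrinks the
  ground set by one point in the induction that computes signs.\<close>

lemma orbit_transpose_comp:
  assumes \<sigma>: "\<sigma> permutes insert a F" and "a \<notin> F" and "\<sigma> a \<noteq> a" and "x \<in> F"
  shows "orbit (transpose a (\<sigma> a) \<circ> \<sigma>) x = orbit \<sigma> x - {a}"
proof -
  define \<tau> where "\<tau> = transpose a (\<sigma> a) \<circ> \<sigma>"
  have \<tau>: "\<tau> permutes F"
    unfolding \<tau>_def using \<sigma> by (rule permutes_insert_lemma)
  have inj: "inj \<sigma>"
    using \<sigma> by (rule permutes_inj)
  \<comment> \<open>Apart from the predecessor of \<open>a\<close>, nothing changes: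
    \<open>\<sigma> y = \<sigma> a\<close> would force \<open>y = a\<close> by injectivity.\<close>
  have \<tau>_eq: "\<tau> y = (if \<sigma> y = a then \<sigma> a else \<sigma> y)" if "y \<noteq> a" for y
    using that inj by (auto simp: \<tau>_def transpose_def dest: injD)
  have sub: "orbit \<tau> x \<subseteq> F"
    using \<tau> \<open>x \<in> F\<close> by (rule permutes_orbit_subset)
  have "x \<noteq> a"
    using assms by blast
  have 1: "y \<in> orbit \<sigma> x" if "y \<in> orbit \<tau> x" for y
    using that
  proof induction
    case base
    show ?case
      using orbit.base[of \<sigma> x] orbit.step[of "\<sigma> x" \<sigma> x] by (auto simp: \<tau>_eq[OF \<open>x \<noteq> a\<close>])
  next
    case (step y)
    have "y \<noteq> a"
      using step sub \<open>a \<notin> F\<close> by blast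
    then show ?case
      using orbit.step[OF step(2)] orbit.step[of "\<sigma> y" \<sigma> x] by (auto simp: \<tau>_eq)
  qed
  \<comment> \<open>The path of \<open>\<sigma>\<close> may pass through \<open>a\<close>, which
    \<open>\<tau>\<close> skips. The invariant at \<open>a\<close> therefore says that the next
    point, \<open>\<sigma> a\<close>, has already been reached.\<close>
  have 2: "if y = a then \<sigma> a \<in> orbit \<tau> x else y \<in> orbit \<tau> x" if "y \<in> orbit \<sigma> x" for y
    using that
  proof induction
    case base
    show ?case
      using orbit.base[of \<tau> x] by (auto simp: \<tau>_eq[OF \<open>x \<noteq> a\<close>] split: if_splits)
  next
    case (step y)
    show ?case
    proof (cases "y = a")
      case True
      then show ?thesis
        using step assms by simp
    next
      case False
      then show ?thesis
        using step orbit.step[of y \<tau> x] by (simp add: \<tau>_eq[OF False] split: if_splits)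
    qed
  qed
  have "a \<notin> orbit \<tau> x"
    using sub \<open>a \<notin> F\<close> by blast
  moreover have "y \<in> orbit \<tau> x" if "y \<in> orbit \<sigma> x" "y \<noteq> a" for y
    using 2[OF that(1)] that(2) by simp
  ultimately show ?thesis
    unfolding \<tau>_def[symmetric] using 1 by fast
qed

lemma orbit_eq_of_mem:
  assumes "\<sigma> permutes A" "finite A" "y \<in> orbit \<sigma> x"
  shows "orbit \<sigma> y = orbit \<sigma> x"
  using cyclic_on_orbit[OF assms(1,2)] assms(3) by (rule orbit_cyclic_eq3)

lemma partition_on_cycle_support:
  assumes "\<sigma> permutes A" "finite A"
  shows "partition_on A (cycle_support A \<sigma>)"
proof (rule partition_onI)
  have self: "x \<in> orbit \<sigma> x" for x
    using assms by (intro permutation_self_in_orbit) (auto simp: permutation_permutes)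
  show "\<Union> (cycle_support A \<sigma>) = A"
    using self permutes_orbit_subset[OF assms(1)] by (fastforce simp: cycle_support_def)
  show "{} \<notin> cycle_support A \<sigma>"
    using self by (auto simp: cycle_support_def)
next
  fix p q assume "p \<in> cycle_support A \<sigma>" "q \<in> cycle_support A \<sigma>" "p \<noteq> q"
  then obtain x y where xy: "p = orbit \<sigma> x" "q = orbit \<sigma> y" "orbit \<sigma> x \<noteq> orbit \<sigma> y"
    by (auto simp: cycle_support_def)
  then show "disjnt p q"
    using orbit_eq_of_mem[OF assms, of _ x] orbit_eq_of_mem[OF assms, of _ y]
    unfolding disjnt_iff by metis
qed

text \<open>Remove one point \<open>a\<close>. If it is fixed, both the number of points and the
  number of cycles drop by one and the sign stays. Otherwise cutting \<open>a\<close> out costs one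
  transposition and one point but keeps the number of cycles.\<close>

lemma sign_eq_card_cycle_support:
  assumes "finite A" "\<sigma> permutes A"
  shows "sign \<sigma> = (- 1) ^ (card A + card (cycle_support A \<sigma>))"
  using assms
proof (induction A arbitrary: \<sigma> rule: finite_induct)
  case empty
  then show ?case by (simp add: cycle_support_def)
next
  case (insert a F)
  show ?case
  proof (cases "\<sigma> a = a")
    case True
    then have \<sigma>: "\<sigma> permutes F"
      using insert.prems insert.hyps by (metis insertE permutes_superset Diff_iff)
    have "cycle_support (insert a F) \<sigma> = insert {a} (cycle_support F \<sigma>)"
      using True by (simp add: cycle_support_def orbit_eq_singleton_iff[THEN iffD2])
    moreover have "{a} \<notin> cycle_support F \<sigma>"
      using permutes_orbit_subset[OF \<sigma>] insert.hyps by (fastforce simp: cycle_support_def)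
    moreover have "finite (cycle_support F \<sigma>)"
      using insert.hyps by (simp add: cycle_support_def)
    ultimately show ?thesis
      using insert.IH[OF \<sigma>] insert.hyps by simp
  next
    case False
    define \<tau> where "\<tau> = transpose a (\<sigma> a) \<circ> \<sigma>"
    have \<tau>: "\<tau> permutes F"
      unfolding \<tau>_def using insert.prems by (rule permutes_insert_lemma)
    have fin: "finite (insert a F)"
      using insert.hyps by simp
    have "\<sigma> a \<in> F"
      using False insert.prems permutes_in_image[of \<sigma> "insert a F" a] by simp
    moreover have "orbit \<sigma> a = orbit \<sigma> (\<sigma> a)"
      using orbit_eq_of_mem[OF insert.prems fin orbit.base] by simp
    ultimately have eq: "cycle_support (insert a F) \<sigma> = orbit \<sigma> ` F"
      by (auto simp: cycle_support_def)
    have "cycle_support F \<tau> = (\<lambda>B. B - {a}) ` (orbit \<sigma> ` F)"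
      unfolding cycle_support_def image_image
      using orbit_transpose_comp[OF insert.prems _ False] insert.hyps by (simp add: \<tau>_def cong: image_cong)
    \<comment> \<open>Each block here is the orbit of some point of \<open>F\<close>, so it keeps
      that point when \<open>a\<close> is deleted; hence no two blocks merge.\<close>
    moreover have "inj_on (\<lambda>B. B - {a}) (orbit \<sigma> ` F)"
    proof (rule inj_onI, clarify)
      fix x y assume xy: "x \<in> F" "y \<in> F" "orbit \<sigma> x - {a} = orbit \<sigma> y - {a}"
      have "x \<in> orbit \<sigma> x"
        using insert.prems fin by (intro permutation_self_in_orbit) (auto simp: permutation_permutes)
      then have "x \<in> orbit \<sigma> y"
        using xy insert.hyps by blast
      then show "orbit \<sigma> x = orbit \<sigma> y"
        by (rule orbit_eq_of_mem[OF insert.prems fin])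
    qed
    ultimately have card: "card (cycle_support (insert a F) \<sigma>) = card (cycle_support F \<tau>)"
      by (simp add: eq card_image)
    have "\<sigma> = transpose a (\<sigma> a) \<circ> \<tau>"
      by (simp add: \<tau>_def fun_eq_iff)
    moreover have "permutation \<tau>"
      using \<tau> insert.hyps by (auto simp: permutation_permutes)
    ultimately have "sign \<sigma> = - sign \<tau>"
      using False by (metis sign_compose permutation_swap_id sign_swap_id mult_minus1)
    then show ?thesis
      using insert.IH[OF \<tau>] insert.hyps by (simp add: card)
  qed
qed

text \<open>Orbits are generated by single steps, so it is enough to test one application of the
  permutation. The pointwise form is what the sign-reversing involution has to preserve.\<close>

lemma refines_cycle_support_iff:
  assumes \<sigma>: "\<sigma> permutes A" and "finite A" and \<pi>: "partition_on A \<pi>"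
  shows "refines A (cycle_support A \<sigma>) \<pi> \<longleftrightarrow> (\<forall>B \<in> \<pi>. \<forall>x \<in> B. \<sigma> x \<in> B)"
proof
  assume ref: "refines A (cycle_support A \<sigma>) \<pi>"
  show "\<forall>B \<in> \<pi>. \<forall>x \<in> B. \<sigma> x \<in> B"
  proof (intro ballI)
    fix B x assume "B \<in> \<pi>" "x \<in> B"
    then have "orbit \<sigma> x \<in> cycle_support A \<sigma>"
      using \<pi> by (auto simp: cycle_support_def partition_on_def)
    then obtain B' where B': "B' \<in> \<pi>" "orbit \<sigma> x \<subseteq> B'"
      using ref by (auto simp: refines_def)
    moreover have "x \<in> orbit \<sigma> x"
      using assms by (intro permutation_self_in_orbit) (auto simp: permutation_permutes)
    ultimately have "B' = B"
      using \<open>B \<in> \<pi>\<close> \<open>x \<in> B\<close> partition_on_unique[OF \<pi>] by blast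
    then show "\<sigma> x \<in> B"
      using B' orbit.base by fastforce
  qed
next
  assume *: "\<forall>B \<in> \<pi>. \<forall>x \<in> B. \<sigma> x \<in> B"
  have "\<exists>B \<in> \<pi>. orbit \<sigma> x \<subseteq> B" if "x \<in> A" for x
  proof -
    obtain B where B: "B \<in> \<pi>" "x \<in> B"
      using \<open>x \<in> A\<close> partition_onD1[OF \<pi>] by blast
    have "y \<in> B" if "y \<in> orbit \<sigma> x" for y
      using that by induction (use * B in auto)
    then show ?thesis
      using B by blast
  qed
  then show "refines A (cycle_support A \<sigma>) \<pi>"
    using partition_on_cycle_support[OF \<sigma> \<open>finite A\<close>] \<pi>
    by (auto simp: refines_def cycle_support_def)
qed


section \<open>Refinement of finite partitions\<close>

text \<open>Choose inside each block of \<open>\<pi>\<close> a block of \<open>\<pi>'\<close>. The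
  choice is injective because the blocks of \<open>\<pi>\<close> are disjoint. If the cardinalities
  agree it is also onto, so no block of \<open>\<pi>\<close> has room for points outside its chosen
  block.\<close>

lemma refines_card_le_and_eq:
  assumes "finite A" and ref: "refines A \<pi>' \<pi>"
  shows "card \<pi> \<le> card \<pi>'" and "card \<pi> = card \<pi>' \<Longrightarrow> \<pi> = \<pi>'"
proof -
  have \<pi>: "partition_on A \<pi>" and \<pi>': "partition_on A \<pi>'"
    using ref by (auto simp: refines_def)
  have fin: "finite \<pi>" "finite \<pi>'"
    using finite_elements[OF \<open>finite A\<close>] \<pi> \<pi>' by blast+
  have "\<forall>B \<in> \<pi>. \<exists>p \<in> \<pi>'. p \<subseteq> B"
  proof
    fix B assume "B \<in> \<pi>"
    then have "B \<noteq> {}" "partition_on B {p \<in> \<pi>'. p \<subseteq> B}"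
      using partition_onD3[OF \<pi>] refines_obtains_subset[OF ref] by auto
    then show "\<exists>p \<in> \<pi>'. p \<subseteq> B"
      by (auto simp: partition_on_def)
  qed
  then obtain g where g: "\<And>B. B \<in> \<pi> \<Longrightarrow> g B \<in> \<pi>' \<and> g B \<subseteq> B"
    by metis
  have ne: "g B \<noteq> {}" if "B \<in> \<pi>" for B
    using g[OF that] partition_onD3[OF \<pi>'] by metis
  have inj: "inj_on g \<pi>"
  proof (rule inj_onI)
    fix B B' assume *: "B \<in> \<pi>" "B' \<in> \<pi>" "g B = g B'"
    then obtain x where "x \<in> g B" "x \<in> g B'"
      using ne by fastforce
    then have "x \<in> B" "x \<in> B'"
      using g *(1,2) by blast+
    then show "B = B'"
      by (rule partition_on_unique[OF \<pi> *(1,2)])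
  qed
  have im: "g ` \<pi> \<subseteq> \<pi>'"
    using g by blast
  show "card \<pi> \<le> card \<pi>'"
    using card_inj_on_le[OF inj im fin(2)] .
  assume "card \<pi> = card \<pi>'"
  then have surj: "g ` \<pi> = \<pi>'"
    using card_image[OF inj] im fin by (metis card_subset_eq)
  have "g B = B" if "B \<in> \<pi>" for B
  proof
    show "B \<subseteq> g B"
    proof
      fix x assume "x \<in> B"
      then have "x \<in> \<Union> \<pi>'"
        using \<pi> \<pi>' that by (auto simp: partition_on_def)
      then obtain B' where B': "B' \<in> \<pi>" "x \<in> g B'"
        using surj by blast
      then have "B' = B"
        using g \<open>x \<in> B\<close> that partition_on_unique[OF \<pi>] by blast
      then show "x \<in> g B"
        using B' by simp
    qed
  qed (use g that in blast)
  then show "\<pi> = \<pi>'"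
    using surj by force
qed

lemmas refines_card_le = refines_card_le_and_eq(1)
  and refines_card_eq_imp_eq = refines_card_le_and_eq(2)

lemma singletons_refines:
  assumes "partition_on V \<pi>"
  shows "refines V (singletons V) \<pi>"
  using assms partition_on_singletons[of V]
  unfolding refines_def singletons_def by (auto dest: partition_onD1)

lemma ex_nonsingleton_block:
  assumes "partition_on V \<pi>" "\<pi> \<noteq> singletons V"
  shows "\<exists>B \<in> \<pi>. \<nexists>v. B = {v}"
proof (rule ccontr)
  assume "\<not> ?thesis"
  then have "\<pi> = singletons V"
    using partition_onD1[OF assms(1)] by (fastforce simp: singletons_def)
  then show False
    using assms(2) by simp
qed

lemma card_singletons [simp]: "card (singletons V) = card V"
  by (simp add: singletons_def card_image)


section \<open>Finite posets\<close>

text \<open>The Moebius recursion has only one solution, by strong induction on the size of a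
  principal ideal. As \<open>z\<close> is the minimum, the interval from \<open>z\<close> to
  \<open>y\<close> is the whole ideal below \<open>y\<close>.\<close>

lemma mobius_eqI:
  assumes fin: "finite (Field r)" and po: "Partial_order r"
    and bot: "\<And>y. y \<in> Field r \<Longrightarrow> (z, y) \<in> r"
    and sum: "\<And>y. y \<in> Field r \<Longrightarrow> (\<Sum>x \<in> {x. (x, y) \<in> r}. f x) = (if y = z then 1 else 0)"
    and "y \<in> Field r"
  shows "mobius r z y = f y"
  using \<open>y \<in> Field r\<close>
proof (induction "card {x. (x, y) \<in> r}" arbitrary: y rule: less_induct)
  case less
  have rf: "(y, y) \<in> r" and tr: "trans r" and asym: "antisym r"
    using po less.prems by (auto simp: partial_order_on_def preorder_on_def refl_on_def)
  have finb: "finite {x. (x, y) \<in> r}"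
    by (rule finite_subset[OF _ fin]) (auto intro: FieldI1)
  have IH: "mobius r z x = f x" if x: "(x, y) \<in> r" "x \<noteq> y" for x
  proof (rule less.hyps)
    have "{w. (w, x) \<in> r} \<subseteq> {w. (w, y) \<in> r}"
      using tr x by (auto dest: transD)
    moreover have "y \<notin> {w. (w, x) \<in> r}"
      using asym x by (auto dest: antisymD)
    ultimately show "card {w. (w, x) \<in> r} < card {w. (w, y) \<in> r}"
      using rf by (intro psubset_card_mono[OF finb]) blast
  qed (use x in \<open>auto intro: FieldI1\<close>)
  \<comment> \<open>Isolating the top term puts the hypothesis on \<open>f\<close> into the shape of
    the recursion.\<close>
  have split: "f y + (\<Sum>x \<in> {x. (x, y) \<in> r} - {y}. f x) = (if y = z then 1 else 0)"
    using sum[OF less.prems] rf finb by (subst (asm) sum.remove[of _ y]) auto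
  show ?case
  proof (cases "y = z")
    case True
    have "{x. (x, y) \<in> r} = {y}"
      using True bot asym rf by (auto dest: antisymD FieldI1)
    then show ?thesis
      using split True fin po rf by (simp add: mobius.simps)
  next
    case False
    have "{x. (z, x) \<in> r \<and> (x, y) \<in> r \<and> x \<noteq> y} = {x. (x, y) \<in> r} - {y}"
      using bot by (auto intro: FieldI1)
    then have "mobius r z y = - (\<Sum>x \<in> {x. (x, y) \<in> r} - {y}. mobius r z x)"
      using False fin po bot[OF less.prems] by (subst mobius.simps) auto
    also have "\<dots> = - (\<Sum>x \<in> {x. (x, y) \<in> r} - {y}. f x)"
      using IH by (intro arg_cong[of _ _ uminus] sum.cong) auto
    finally show ?thesis
      using split False by simp
  qed
qed

lemma poset_bot_eqI:
  assumes "antisym r" "z \<in> Field r" "\<And>y. y \<in> Field r \<Longrightarrow> (z, y) \<in> r"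
  shows "poset_bot r = z"
  unfolding poset_bot_def using assms by (intro the_equality) (auto dest: antisymD)

lemma poset_length_eqI:
  assumes "finite (Field r)" "C \<in> Chains r" "card C = Suc n"
    and "\<And>C. C \<in> Chains r \<Longrightarrow> card C \<le> Suc n"
  shows "poset_length r = n"
proof -
  have "Chains r \<subseteq> Pow (Field r)"
    by (auto simp: Chains_def intro: FieldI1)
  then have "finite (Chains r)"
    using assms(1) by (metis finite_Pow_iff finite_subset)
  then have "Max (card ` Chains r) = Suc n"
    using assms by (intro Max_eqI) (auto simp: rev_image_eqI)
  then show ?thesis
    by (simp add: poset_length_def)
qed

section \<open>Connected sets of vertices\<close>

text \<open>An order-theoretic test that replaces connectivity of \<open>Gamma B\<close>. The
  witnesses \<open>a\<close> and \<open>b\<close> can only be the minimum and the maximum of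
  \<open>B\<close>.\<close>

definition anchored :: "nat set \<Rightarrow> bool" where
  "anchored B \<longleftrightarrow>
     (\<exists>v. B = {v}) \<or> (\<exists>a \<in> B. \<exists>b \<in> B. odd a \<and> even b \<and> (\<forall>x \<in> B. a \<le> x \<and> x \<le> b))"

text \<open>Adjacency depends only on the order and the parities of the two endpoints, not on the
  ambient set.\<close>

lemma induce_Gamma: "B \<subseteq> A \<Longrightarrow> Gamma A \<restriction> B = Gamma B"
  by (auto simp: induce_subgraph_def with_proj_def Gamma_pair_def)

lemma mk_symmetric_Gamma: "mk_symmetric (Gamma A) = Gamma_pair A"
  by (auto simp: mk_symmetric_def Gamma_pair_def)

lemma sym_digraph_Gamma: "sym_digraph (Gamma A)"
proof -
  interpret pair_wf_digraph "Gamma_pair A"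
    by unfold_locales (auto simp: Gamma_pair_def)
  show ?thesis
    by (rule sym_digraphI) (auto simp: Gamma_pair_def symmetric_def sym_def)
qed

lemma arc_Gamma_iff:
  "u \<rightarrow>\<^bsub>Gamma A\<^esub> v \<longleftrightarrow>
     u \<in> A \<and> v \<in> A \<and> (u < v \<and> odd u \<and> even v \<or> v < u \<and> odd v \<and> even u)"
  by (auto simp: Gamma_pair_def)

lemma verts_Gamma [simp]: "verts (Gamma A) = A" "pverts (Gamma_pair A) = A"
  by (simp_all add: Gamma_pair_def)

lemma reachable_Gamma_imp_arc:
  assumes "u \<rightarrow>\<^sup>*\<^bsub>Gamma B\<^esub> v" "u \<noteq> v"
  shows "\<exists>w. u \<rightarrow>\<^bsub>Gamma B\<^esub> w"
proof -
  have "u = v \<or> (\<exists>w. u \<rightarrow>\<^bsub>Gamma B\<^esub> w)"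
    using assms(1) unfolding reachable_def by (induction rule: converse_rtrancl_on_induct) blast+
  then show ?thesis
    using assms(2) by blast
qed

text \<open>In a connected set with at least two vertices none is isolated; the minimum has only
  larger neighbours, so it is odd, and dually the maximum is even. Conversely \<open>a\<close> is
  adjacent to all even vertices and \<open>b\<close> to all odd ones, so every vertex reaches
  \<open>b\<close>, and symmetry gives the way back.\<close>

lemma strongly_connected_Gamma_iff:
  assumes "finite B"
  shows "strongly_connected (Gamma B) \<longleftrightarrow> anchored B"
proof
  assume conn: "strongly_connected (Gamma B)"
  show "anchored B"
  proof (cases "\<exists>v. B = {v}")
    case False
    have "B \<noteq> {}"
      using conn by (simp add: strongly_connected_def Gamma_pair_def)
    have arc: "\<exists>w. x \<rightarrow>\<^bsub>Gamma B\<^esub> w" if "x \<in> B" for x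
    proof -
      obtain y where "y \<in> B" "x \<noteq> y"
        using False \<open>x \<in> B\<close> by blast
      then show ?thesis
        using conn that reachable_Gamma_imp_arc
        unfolding strongly_connected_def verts_Gamma by blast
    qed
    have "Min B \<in> B" "Max B \<in> B"
      using assms \<open>B \<noteq> {}\<close> by simp_all
    moreover have "odd (Min B)"
      using arc[OF \<open>Min B \<in> B\<close>] assms unfolding arc_Gamma_iff by (auto dest: Min_le[OF assms])
    moreover have "even (Max B)"
      using arc[OF \<open>Max B \<in> B\<close>] assms unfolding arc_Gamma_iff by (auto dest: Max_ge[OF assms])
    ultimately show ?thesis
      unfolding anchored_def using Min_le[OF assms] Max_ge[OF assms] by blast
  qed (simp add: anchored_def)
next
  interpret sym_digraph "Gamma B"
    by (rule sym_digraph_Gamma)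
  assume "anchored B"
  then consider v where "B = {v}"
    | a b where "a \<in> B" "b \<in> B" "odd a" "even b" "\<And>x. x \<in> B \<Longrightarrow> a \<le> x \<and> x \<le> b"
    unfolding anchored_def by blast
  then show "strongly_connected (Gamma B)"
  proof cases
    case 1
    then show ?thesis
      by (auto simp: strongly_connected_def reachable_def)
  next
    case 2
    have le: "x \<rightarrow>\<^bsub>Gamma B\<^esub> y" if "x \<in> B" "y \<in> B" "odd x" "even y" "x \<le> y" for x y
      using that unfolding arc_Gamma_iff by (metis le_neq_implies_less)
    have "x \<rightarrow>\<^sup>*\<^bsub>Gamma B\<^esub> b" if "x \<in> B" for x
    proof (cases "even x")
      case True
      have "x \<rightarrow>\<^bsub>Gamma B\<^esub> a"
        using le[of a x] 2 that True graph_symmetric by blast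
      moreover have "a \<rightarrow>\<^bsub>Gamma B\<^esub> b"
        using le 2 by blast
      ultimately show ?thesis
        by (meson adj_reachable_trans reachable_adjI)
    next
      case False
      then show ?thesis
        using le[of x b] 2 that reachable_adjI by blast
    qed
    then have "x \<rightarrow>\<^sup>*\<^bsub>Gamma B\<^esub> y" if "x \<in> B" "y \<in> B" for x y
      using that symmetric_reachable[OF sym_arcs] reachable_trans by blast
    then show ?thesis
      using \<open>b \<in> B\<close> unfolding strongly_connected_def verts_Gamma by blast
  qed
qed

lemma connected_Gamma_iff: "Digraph_Component.connected (Gamma A) \<longleftrightarrow> strongly_connected (Gamma A)"
  by (simp add: Digraph_Component.connected_def mk_symmetric_Gamma)

lemma bond_partitions_Gamma:
  assumes "finite A"
  shows "bond_partitions (Gamma A) = {\<pi>. partition_on A \<pi> \<and> (\<forall>B \<in> \<pi>. anchored B)}"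
proof -
  have "Digraph_Component.connected (Gamma A \<restriction> B) \<longleftrightarrow> anchored B"
    if "partition_on A \<pi>" "B \<in> \<pi>" for B \<pi>
  proof -
    have "B \<subseteq> A"
      using that by (auto simp: partition_on_def)
    then show ?thesis
      using finite_subset[OF _ assms]
      by (simp add: induce_Gamma connected_Gamma_iff strongly_connected_Gamma_iff)
  qed
  then show ?thesis
    unfolding bond_partitions_def verts_Gamma by blast
qed

section \<open>Cycles of D-permutations\<close>

text \<open>A nontrivial cycle fixes none of its points, so its minimum moves strictly up and its
  maximum strictly down. A D-permutation allows the first only at odd and the second only at even
  points.\<close>

lemma anchored_orbit:
  assumes \<sigma>: "\<sigma> \<in> D_perms A" and "finite A" and "x \<in> A"
  shows "anchored (orbit \<sigma> x)"
proof (cases "\<exists>v. orbit \<sigma> x = {v}")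
  case False
  have perm: "\<sigma> permutes A"
    using \<sigma> by (simp add: D_perms_def)
  have sub: "orbit \<sigma> x \<subseteq> A"
    using perm \<open>x \<in> A\<close> by (rule permutes_orbit_subset)
  have fin: "finite (orbit \<sigma> x)"
    using sub \<open>finite A\<close> by (rule finite_subset)
  have ne: "orbit \<sigma> x \<noteq> {}"
    by (rule orbit_nonempty)
  have move: "\<sigma> y \<noteq> y" if "y \<in> orbit \<sigma> x" for y
    using False orbit_eq_of_mem[OF perm \<open>finite A\<close> that] orbit_eq_singleton_iff[of \<sigma> y] by metis
  define a b where "a = Min (orbit \<sigma> x)" and "b = Max (orbit \<sigma> x)"
  have mem: "a \<in> orbit \<sigma> x" "b \<in> orbit \<sigma> x"
    unfolding a_def b_def using fin ne by simp_all
  have bounds: "a \<le> y" "y \<le> b" if "y \<in> orbit \<sigma> x" for y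
    unfolding a_def b_def using fin that by simp_all
  have "\<sigma> a > a" "\<sigma> b < b"
    using bounds(1)[OF orbit.step[OF mem(1)]] bounds(2)[OF orbit.step[OF mem(2)]]
      move[OF mem(1)] move[OF mem(2)] by linarith+
  then have "odd a" "even b"
    using \<sigma> mem sub unfolding D_perms_def by (fastforce simp: subset_iff)+
  then show ?thesis
    unfolding anchored_def using mem bounds by blast
qed (simp add: anchored_def)

lemma cycle_support_in_bond_partitions:
  assumes "\<sigma> \<in> D_perms A" and "finite A"
  shows "cycle_support A \<sigma> \<in> bond_partitions (Gamma A)"
  using assms partition_on_cycle_support[of \<sigma> A] anchored_orbit[OF assms]
  by (auto simp: bond_partitions_Gamma D_perms_def cycle_support_def)


section \<open>The Moebius function of the bond lattice\<close>

lemma Field_bond_lattice: "Field (bond_lattice G) = bond_partitions G"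
  by (auto simp: Field_def bond_lattice_def bond_partitions_def intro: refines_refl)

lemma bond_lattice_refl: "\<pi> \<in> bond_partitions G \<Longrightarrow> (\<pi>, \<pi>) \<in> bond_lattice G"
  by (auto simp: bond_lattice_def bond_partitions_def intro: refines_refl)

lemma Partial_order_bond_lattice: "Partial_order (bond_lattice G)"
proof -
  have "refl_on (bond_partitions G) (bond_lattice G)"
    using bond_lattice_refl by (blast intro: refl_onI)
  moreover have "trans (bond_lattice G)"
    by (rule transI) (auto simp: bond_lattice_def intro: refines_trans)
  moreover have "antisym (bond_lattice G)"
    by (rule antisymI) (use refines_asym in \<open>unfold bond_lattice_def, blast\<close>)
  ultimately show ?thesis
    unfolding partial_order_on_def preorder_on_def Field_bond_lattice
    by (auto simp: bond_lattice_def)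
qed

lemma finite_bond_partitions:
  assumes "finite (verts G)"
  shows "finite (bond_partitions G)"
proof (rule finite_subset)
  show "bond_partitions G \<subseteq> Pow (Pow (verts G))"
    by (auto simp: bond_partitions_def partition_on_def)
qed (simp add: assms)

lemma singletons_in_bond_partitions:
  "finite A \<Longrightarrow> singletons A \<in> bond_partitions (Gamma A)"
  using partition_on_singletons[of A]
  by (auto simp: bond_partitions_Gamma singletons_def anchored_def)

lemma singletons_bond_lattice:
  assumes "finite A" "\<pi> \<in> bond_partitions (Gamma A)"
  shows "(singletons A, \<pi>) \<in> bond_lattice (Gamma A)"
  using assms singletons_in_bond_partitions[OF assms(1)] singletons_refines[of A \<pi>]
  by (simp add: bond_lattice_def bond_partitions_Gamma)

section \<open>Signed sums over D-permutations\<close>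

lemma finite_D_perms: "finite A \<Longrightarrow> finite (D_perms A)"
  by (rule finite_subset[OF _ finite_permutations[of A]]) (auto simp: D_perms_def)

text \<open>This is the sum over a principal ideal that \<open>mobius_eqI\<close> asks for, before
  the permutations are sorted by cycle support.\<close>

lemma sum_sign_D_perms_refining:
  assumes "finite A" and \<pi>: "\<pi> \<in> bond_partitions (Gamma A)"
  shows "(\<Sum>\<sigma> \<in> {\<sigma> \<in> D_perms A. refines A (cycle_support A \<sigma>) \<pi>}. sign \<sigma>)
           = (if \<pi> = singletons A then 1 else 0)"
proof -
  define S where "S = {\<sigma> \<in> D_perms A. refines A (cycle_support A \<sigma>) \<pi>}"
  have part: "partition_on A \<pi>" and anch: "\<And>B. B \<in> \<pi> \<Longrightarrow> anchored B"
    using assms by (auto simp: bond_partitions_Gamma)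
  have S_iff: "\<sigma> \<in> S \<longleftrightarrow> \<sigma> \<in> D_perms A \<and> (\<forall>B \<in> \<pi>. \<forall>x \<in> B. \<sigma> x \<in> B)" for \<sigma>
    using refines_cycle_support_iff[OF _ \<open>finite A\<close> part] by (auto simp: S_def D_perms_def)
  show ?thesis
  proof (cases "\<pi> = singletons A")
    case True
    \<comment> \<open>Preserving every singleton block means fixing every point.\<close>
    have "S = {id}"
    proof (intro equalityI subsetI)
      fix \<sigma> assume "\<sigma> \<in> S"
      then have "\<sigma> permutes A" "\<forall>x \<in> A. \<sigma> x = x"
        by (auto simp: S_iff True singletons_def D_perms_def)
      then have "\<sigma> = id"
        by (metis eq_id_iff permutes_not_in)
      then show "\<sigma> \<in> {id}" by simp
    qed (auto simp: S_iff D_perms_def permutes_id)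
    then show ?thesis
      unfolding S_def[symmetric] using True by simp
  next
    case False
    then obtain B a b where B: "B \<in> \<pi>" "a \<in> B" "b \<in> B" "odd a" "even b"
      and bounds: "\<And>x. x \<in> B \<Longrightarrow> a \<le> x" "\<And>x. x \<in> B \<Longrightarrow> x \<le> b"
      using ex_nonsingleton_block[OF part False] anch unfolding anchored_def by metis
    have ab: "a \<in> A" "b \<in> A" "a \<noteq> b"
      using B part by (auto simp: partition_on_def)
    txt \<open>
      Since a and b are the extreme elements of B, every D-permutation that preserves B
      remains one when its values at a and b are exchanged.
    \<close>
    define t where "t = (\<lambda>\<sigma> :: nat \<Rightarrow> nat. \<sigma> \<circ> transpose a b)"
    have tt: "t (t \<sigma>) = \<sigma>" for \<sigma>
      by (simp add: t_def fun_eq_iff)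
    have tS: "t \<sigma> \<in> S" if "\<sigma> \<in> S" for \<sigma>
    proof -
      have \<sigma>: "\<sigma> permutes A" "\<forall>B \<in> \<pi>. \<forall>x \<in> B. \<sigma> x \<in> B"
        using that by (auto simp: S_iff D_perms_def)
      \<comment> \<open>Both swapped points lie in \<open>B\<close> and in no other block, so the
        exchange cannot spoil the invariance of any block.\<close>
      have B_iff: "a \<in> B' \<longleftrightarrow> B' = B" "b \<in> B' \<longleftrightarrow> B' = B" if "B' \<in> \<pi>" for B'
        using partition_on_unique[OF part] that B by blast+
      have "t \<sigma> permutes A"
        unfolding t_def using ab \<sigma>(1) by (intro permutes_compose permutes_swap_id)
      moreover have "\<forall>B' \<in> \<pi>. \<forall>x \<in> B'. t \<sigma> x \<in> B'"
        using \<sigma>(2) B B_iff by (auto simp: t_def transpose_def)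
      \<comment> \<open>These are the two D-conditions that change: \<open>t \<sigma>\<close> takes
        the value \<open>\<sigma> b\<close> at the odd point \<open>a\<close> and
        \<open>\<sigma> a\<close> at the even point \<open>b\<close>. Both values lie in
        \<open>B\<close>, between its extremes.\<close>
      moreover have "a \<le> \<sigma> b" "\<sigma> a \<le> b"
        using \<sigma>(2) B bounds by blast+
      ultimately show ?thesis
        using that B(4,5) unfolding S_iff D_perms_def by (auto simp: t_def transpose_def)
    qed
    have "sign (t \<sigma>) = - sign \<sigma>" if "\<sigma> \<in> S" for \<sigma>
    proof -
      have "permutation \<sigma>"
        using that \<open>finite A\<close> by (auto simp: S_iff D_perms_def permutation_permutes)
      then show ?thesis
        using ab by (simp add: t_def sign_compose permutation_swap_id sign_swap_id)
    qed
    \<comment> \<open>Reindexing along the involution \<open>t\<close> shows that the sum equals its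
      own negative, so it is zero.\<close>
    then have "sum sign S = (\<Sum>\<sigma> \<in> S. - sign \<sigma>)"
      using tt tS by (intro sum.reindex_bij_witness[of _ t t]) auto
    then show ?thesis
      unfolding S_def[symmetric] using False by (simp add: sum_negf)
  qed
qed

theorem mobius_bond_lattice_Gamma:
  assumes "finite A" and \<pi>: "\<pi> \<in> bond_partitions (Gamma A)"
  shows "mobius (bond_lattice (Gamma A)) (singletons A) \<pi>
           = (\<Sum>\<sigma> \<in> {\<sigma> \<in> D_perms A. cycle_support A \<sigma> = \<pi>}. sign \<sigma>)"
proof (rule mobius_eqI)
  let ?r = "bond_lattice (Gamma A)"
  show fin: "finite (Field ?r)"
    using assms by (simp add: Field_bond_lattice finite_bond_partitions)
  show "Partial_order ?r"
    by (rule Partial_order_bond_lattice)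
  show "(singletons A, \<pi>) \<in> ?r" if "\<pi> \<in> Field ?r" for \<pi>
    using that \<open>finite A\<close> by (simp add: singletons_bond_lattice Field_bond_lattice)
  show "\<pi> \<in> Field ?r"
    using \<pi> by (simp add: Field_bond_lattice)
next
  let ?r = "bond_lattice (Gamma A)"
  fix \<pi> assume "\<pi> \<in> Field ?r"
  then have \<pi>: "\<pi> \<in> bond_partitions (Gamma A)"
    by (simp add: Field_bond_lattice)
  define T where "T = {\<pi>'. (\<pi>', \<pi>) \<in> ?r}"
  define S where "S = {\<sigma> \<in> D_perms A. refines A (cycle_support A \<sigma>) \<pi>}"
  have T: "T = {\<pi>' \<in> bond_partitions (Gamma A). refines A \<pi>' \<pi>}"
    using \<pi> by (auto simp: T_def bond_lattice_def)
  have "finite T"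
    using \<open>finite A\<close> by (simp add: T finite_bond_partitions)
  moreover have "finite S"
    using \<open>finite A\<close> by (simp add: S_def finite_D_perms)
  moreover have "cycle_support A ` S \<subseteq> T"
    using \<open>finite A\<close> by (auto simp: S_def T cycle_support_in_bond_partitions)
  \<comment> \<open>Each permutation in \<open>S\<close> is counted once, at its own cycle support,
    which is a bond partition below \<open>\<pi>\<close>.\<close>
  ultimately have "(\<Sum>\<pi>' \<in> T. \<Sum>\<sigma> \<in> {\<sigma> \<in> S. cycle_support A \<sigma> = \<pi>'}. sign \<sigma>) = sum sign S"
    by (intro sum.group)
  moreover have "{\<sigma> \<in> S. cycle_support A \<sigma> = \<pi>'} = {\<sigma> \<in> D_perms A. cycle_support A \<sigma> = \<pi>'}"
    if "\<pi>' \<in> T" for \<pi>'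
    using that by (auto simp: S_def T)
  ultimately show "(\<Sum>\<pi>' \<in> {\<pi>'. (\<pi>', \<pi>) \<in> ?r}.
      \<Sum>\<sigma> \<in> {\<sigma> \<in> D_perms A. cycle_support A \<sigma> = \<pi>'}. sign \<sigma>) = (if \<pi> = singletons A then 1 else 0)"
    using sum_sign_D_perms_refining[OF \<open>finite A\<close> \<pi>]
    by (simp add: T_def[symmetric] S_def[symmetric])
qed


section \<open>Ranks in the bond lattice\<close>

text \<open>Removing a vertex other than the two extremes keeps both anchors. If there is no such
  vertex, removing one extreme leaves a singleton.\<close>

lemma ex_anchored_split:
  assumes "anchored B" and "\<nexists>v. B = {v}"
  obtains x where "x \<in> B" "anchored (B - {x})"
proof -
  obtain a b where ab: "a \<in> B" "b \<in> B" "odd a" "even b" "\<And>x. x \<in> B \<Longrightarrow> a \<le> x \<and> x \<le> b"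
    using assms unfolding anchored_def by blast
  show ?thesis
  proof (cases "B = {a, b}")
    case True
    then have "B - {a} = {b}"
      using ab by auto
    then show ?thesis
      using that[of a] ab by (simp add: anchored_def)
  next
    case False
    then obtain x where "x \<in> B" "x \<noteq> a" "x \<noteq> b"
      using ab by blast
    then show ?thesis
      using that[of x] ab unfolding anchored_def by (metis Diff_iff singletonD)
  qed
qed

text \<open>Split a single vertex off a block that is not a singleton, so that the rest of the block
  stays connected.\<close>

lemma ex_finer_bond_partition:
  assumes "finite A" and \<pi>: "\<pi> \<in> bond_partitions (Gamma A)" and "\<pi> \<noteq> singletons A"
  obtains \<pi>' where "\<pi>' \<in> bond_partitions (Gamma A)" "refines A \<pi>' \<pi>" "card \<pi>' = Suc (card \<pi>)"
proof -
  have part: "partition_on A \<pi>" and anch: "\<And>B. B \<in> \<pi> \<Longrightarrow> anchored B"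
    using assms by (auto simp: bond_partitions_Gamma)
  obtain B where B: "B \<in> \<pi>" "\<nexists>v. B = {v}"
    using ex_nonsingleton_block[OF part assms(3)] by blast
  then obtain x where x: "x \<in> B" "anchored (B - {x})"
    using anch ex_anchored_split by metis
  have ne: "B - {x} \<noteq> {}"
    using x(1) B(2) by blast
  define \<rho> where "\<rho> = \<pi> - {B}"
  have \<pi>_eq: "\<pi> = insert B \<rho>" "B \<notin> \<rho>"
    using B by (auto simp: \<rho>_def)
  have disj: "disjnt B (\<Union>\<rho>)"
    using partition_on_unique[OF part] B by (fastforce simp: \<rho>_def disjnt_iff)
  have \<rho>: "partition_on (A - B) \<rho>" "B \<subseteq> A"
    using part disj unfolding \<pi>_eq by (simp_all add: partition_on_insert)
  define \<pi>' where "\<pi>' = insert {x} (insert (B - {x}) \<rho>)"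
  \<comment> \<open>The two new blocks differ from each other and from the blocks kept in
    \<open>\<rho>\<close>, so the number of blocks grows by exactly one.\<close>
  have notin: "B - {x} \<notin> \<rho>" "{x} \<notin> \<rho>" "{x} \<noteq> B - {x}"
    using disj ne x(1) by (auto simp: disjnt_def)
  have "A - {x} - (B - {x}) = A - B"
    using x by blast
  then have part': "partition_on A \<pi>'"
    using \<rho> disj ne x(1) unfolding \<pi>'_def
    by (subst partition_on_insert; (subst partition_on_insert)?) (auto simp: disjnt_iff)
  have "\<pi>' \<in> bond_partitions (Gamma A)"
    using part' anch x \<open>finite A\<close> by (auto simp: bond_partitions_Gamma \<pi>'_def \<rho>_def anchored_def[of "{x}"])
  moreover have "refines A \<pi>' \<pi>"
    using part part' x(1) unfolding refines_def \<pi>'_def \<pi>_eq by blast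
  moreover have "finite \<rho>"
    using finite_elements[OF _ \<rho>(1)] \<open>finite A\<close> by blast
  then have "card \<pi>' = Suc (card \<pi>)"
    using notin by (simp add: \<pi>'_def \<pi>_eq)
  ultimately show ?thesis
    using that by blast
qed

lemma card_bond_partition_le:
  assumes "finite A" "\<pi> \<in> bond_partitions (Gamma A)"
  shows "card \<pi> \<le> card A"
  using refines_card_le[OF \<open>finite A\<close> singletons_refines[of A \<pi>]] assms
  by (simp add: bond_partitions_Gamma)

text \<open>Splitting off one vertex at a time adds one block per step until there are
  \<open>card A\<close> blocks. The resulting chain attains the upper bound used for the
  rank.\<close>

lemma ex_maximal_chain_below:
  assumes "finite A" "\<pi> \<in> bond_partitions (Gamma A)"
  shows "\<exists>C \<in> Chains (bond_lattice (Gamma A)).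
           (\<forall>\<rho> \<in> C. (\<rho>, \<pi>) \<in> bond_lattice (Gamma A)) \<and> card C = Suc (card A - card \<pi>)"
  using assms(2)
proof (induction "card A - card \<pi>" arbitrary: \<pi>)
  case 0
  then show ?case
    using bond_lattice_refl[of \<pi> "Gamma A"] by (intro bexI[of _ "{\<pi>}"]) (auto simp: Chains_def)
next
  case (Suc n)
  let ?r = "bond_lattice (Gamma A)"
  have po: "Partial_order ?r"
    by (rule Partial_order_bond_lattice)
  have refl: "(\<pi>, \<pi>) \<in> ?r"
    using Suc.prems by (rule bond_lattice_refl)
  have "\<pi> \<noteq> singletons A"
    using Suc.hyps(2) by auto
  then obtain \<pi>' where \<pi>': "\<pi>' \<in> bond_partitions (Gamma A)" "refines A \<pi>' \<pi>" "card \<pi>' = Suc (card \<pi>)"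
    using ex_finer_bond_partition[OF \<open>finite A\<close> Suc.prems] by blast
  obtain C where C: "C \<in> Chains ?r" "\<forall>\<rho> \<in> C. (\<rho>, \<pi>') \<in> ?r" "card C = Suc (card A - card \<pi>')"
    using Suc.hyps(1)[OF _ \<pi>'(1)] Suc.hyps(2) \<pi>'(3) by force
  have below: "(\<pi>', \<pi>) \<in> ?r"
    using \<pi>' Suc.prems by (simp add: bond_lattice_def)
  then have C_below: "\<forall>\<rho> \<in> C. (\<rho>, \<pi>) \<in> ?r"
    using C(2) po by (meson partial_order_on_def preorder_on_def transD)
  have "\<pi> \<notin> C"
  proof
    assume "\<pi> \<in> C"
    then have "\<pi> = \<pi>'"
      using C(2) below po by (auto simp: partial_order_on_def dest: antisymD)
    then show False
      using \<pi>'(3) by simp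
  qed
  moreover have "finite C"
    using C(3) by (metis card.infinite nat.distinct(1))
  ultimately have "card (insert \<pi> C) = Suc (card A - card \<pi>)"
    using C(3) \<pi>'(3) Suc.hyps(2) by simp
  moreover have "insert \<pi> C \<in> Chains ?r"
    using C(1) C_below refl by (auto simp: Chains_def)
  ultimately show ?case
    using C_below refl by (intro bexI[of _ "insert \<pi> C"]) auto
qed

text \<open>Comparable partitions with equally many blocks coincide, so the number of blocks is
  injective on a chain. Below \<open>\<pi>\<close> it takes values from \<open>card \<pi>\<close> to
  \<open>card A\<close>, which bounds every chain; splitting off vertices attains the bound.\<close>

lemma poset_rank_bond_lattice_Gamma:
  assumes "finite A" "\<pi> \<in> bond_partitions (Gamma A)"
  shows "poset_rank (bond_lattice (Gamma A)) \<pi> = card A - card \<pi>"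
proof -
  let ?r = "bond_lattice (Gamma A)"
  let ?s = "Restr ?r (under ?r \<pi>)"
  obtain C where C: "C \<in> Chains ?r" "\<forall>\<rho> \<in> C. (\<rho>, \<pi>) \<in> ?r" "card C = Suc (card A - card \<pi>)"
    using ex_maximal_chain_below[OF assms] by blast
  show ?thesis
    unfolding poset_rank_def
  proof (rule poset_length_eqI)
    have "Field ?s \<subseteq> Field ?r"
      by (auto simp: Field_def)
    then show "finite (Field ?s)"
      using assms finite_bond_partitions[of "Gamma A"]
      by (simp add: Field_bond_lattice finite_subset)
    show "C \<in> Chains ?s"
      using C by (auto simp: Chains_def under_def)
    show "card C = Suc (card A - card \<pi>)"
      by (rule C)
    fix D assume D: "D \<in> Chains ?s"
    have "inj_on card D"
    proof (rule inj_onI)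
      fix \<rho> \<rho>' assume "\<rho> \<in> D" "\<rho>' \<in> D" "card \<rho> = card \<rho>'"
      moreover from this have "refines A \<rho> \<rho>' \<or> refines A \<rho>' \<rho>"
        using D by (auto simp: Chains_def bond_lattice_def)
      ultimately show "\<rho> = \<rho>'"
        using refines_card_eq_imp_eq[OF \<open>finite A\<close>] by metis
    qed
    moreover have "card ` D \<subseteq> {card \<pi>..card A}"
    proof (clarsimp, intro conjI)
      fix \<rho> assume "\<rho> \<in> D"
      then have \<rho>: "refines A \<rho> \<pi>" "\<rho> \<in> bond_partitions (Gamma A)"
        using D by (auto simp: Chains_def under_def bond_lattice_def)
      show "card \<pi> \<le> card \<rho>"
        using refines_card_le[OF \<open>finite A\<close> \<rho>(1)] .
      show "card \<rho> \<le> card A"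
        by (rule card_bond_partition_le[OF \<open>finite A\<close> \<rho>(2)])
    qed
    ultimately have "card D \<le> card {card \<pi>..card A}"
      by (intro card_inj_on_le) auto
    then show "card D \<le> Suc (card A - card \<pi>)"
      using card_bond_partition_le[OF assms] by simp
  qed
qed

section \<open>Connected components and the length of the bond lattice\<close>

text \<open>The partition into connected components is the maximum of the bond lattice, since a
  connected block lies inside the component of any of its points.\<close>

lemma components_bond_partition:
  assumes "finite A"
  defines "\<kappa> \<equiv> pre_digraph.sccs_verts (Gamma A)"
  shows "\<kappa> \<in> bond_partitions (Gamma A)"
    and "card \<kappa> = num_components (Gamma A)"
    and "\<And>\<pi>. \<pi> \<in> bond_partitions (Gamma A) \<Longrightarrow> refines A \<pi> \<kappa>"
proof -
  interpret sym_digraph "Gamma A"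
    by (rule sym_digraph_Gamma)
  have \<kappa>: "partition_on A \<kappa>"
  proof (rule partition_onI)
    have "x \<in> \<Union>\<kappa>" if "x \<in> A" for x
      using scc_of_in_sccs_verts in_scc_of_self that unfolding \<kappa>_def verts_Gamma by blast
    then show "\<Union>\<kappa> = A"
      using sccs_verts_subsets unfolding \<kappa>_def verts_Gamma by blast
    show "{} \<notin> \<kappa>"
      by (simp add: \<kappa>_def in_sccs_verts_conv_reachable)
    show "disjnt p q" if "p \<in> \<kappa>" "q \<in> \<kappa>" "p \<noteq> q" for p q
      using that sccs_verts_disjoint by (auto simp: \<kappa>_def disjnt_def)
  qed
  have "anchored B" if "B \<in> \<kappa>" for B
  proof -
    have "Gamma A \<restriction> B \<in> sccs"
      using that unfolding \<kappa>_def by (rule in_verts_sccsD_sccs)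
    moreover have "B \<subseteq> A"
      using that sccs_verts_subsets unfolding \<kappa>_def verts_Gamma by blast
    ultimately have "strongly_connected (Gamma B)"
      by (auto simp: sccs_def induce_Gamma)
    then show ?thesis
      using strongly_connected_Gamma_iff finite_subset[OF \<open>B \<subseteq> A\<close> \<open>finite A\<close>] by blast
  qed
  then show "\<kappa> \<in> bond_partitions (Gamma A)"
    using \<kappa> \<open>finite A\<close> by (simp add: bond_partitions_Gamma)
  show "card \<kappa> = num_components (Gamma A)"
    by (simp add: \<kappa>_def num_components_def mk_symmetric_Gamma card_sccs_verts)
  show "refines A \<pi> \<kappa>" if \<pi>: "\<pi> \<in> bond_partitions (Gamma A)" for \<pi>
  proof -
    have "\<exists>K \<in> \<kappa>. B \<subseteq> K" if "B \<in> \<pi>" for B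
    proof -
      have part: "partition_on A \<pi>" and anch: "anchored B"
        using \<pi> \<open>B \<in> \<pi>\<close> \<open>finite A\<close> by (auto simp: bond_partitions_Gamma)
      have "B \<subseteq> A"
        using partition_onD1[OF part] \<open>B \<in> \<pi>\<close> by blast
      then have conn: "strongly_connected (Gamma A \<restriction> B)"
        using anch \<open>finite A\<close> by (simp add: induce_Gamma strongly_connected_Gamma_iff finite_subset)
      obtain x where "x \<in> B"
        using partition_onD3[OF part] \<open>B \<in> \<pi>\<close> by fastforce
      have "B \<subseteq> scc_of x"
      proof
        fix y assume "y \<in> B"
        then have "x \<rightarrow>\<^sup>*\<^bsub>Gamma A \<restriction> B\<^esub> y"
          using conn \<open>x \<in> B\<close> by (simp add: strongly_connected_def)
        then have "x \<rightarrow>\<^sup>*\<^bsub>Gamma A\<^esub> y"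
          using \<open>B \<subseteq> A\<close> by (intro reachable_induce_subgraphD) auto
        then show "y \<in> scc_of x"
          by (rule scc_ofI_reachable')
      qed
      moreover have "scc_of x \<in> \<kappa>"
        using \<open>x \<in> B\<close> \<open>B \<subseteq> A\<close> unfolding \<kappa>_def by (intro scc_of_in_sccs_verts) auto
      ultimately show ?thesis
        by blast
    qed
    then show ?thesis
      using \<kappa> \<pi> \<open>finite A\<close> by (auto simp: refines_def bond_partitions_Gamma)
  qed
qed

text \<open>The whole lattice is the principal ideal below its maximum \<open>\<kappa>\<close>, so
  its length is the rank of \<open>\<kappa>\<close>.\<close>

lemma poset_length_bond_lattice_Gamma:
  assumes "finite A"
  shows "poset_length (bond_lattice (Gamma A)) = card A - num_components (Gamma A)"
proof -
  let ?r = "bond_lattice (Gamma A)"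
  define \<kappa> where "\<kappa> = pre_digraph.sccs_verts (Gamma A)"
  note \<kappa> = components_bond_partition[OF assms, folded \<kappa>_def]
  have "under ?r \<kappa> = Field ?r"
    using \<kappa>(1,3) unfolding Field_bond_lattice by (auto simp: under_def bond_lattice_def)
  moreover have "?r \<subseteq> Field ?r \<times> Field ?r"
    by (auto intro: FieldI1 FieldI2)
  ultimately have "Restr ?r (under ?r \<kappa>) = ?r"
    by (simp add: Int_absorb2)
  then show ?thesis
    using poset_rank_bond_lattice_Gamma[OF assms \<kappa>(1)] \<kappa>(2) by (simp add: poset_rank_def)
qed

section \<open>The characteristic polynomial\<close>

theorem characteristic_poly_bond_lattice_Gamma:
  assumes "finite A"
  defines "c \<equiv> num_components (Gamma A)"
  shows "characteristic_poly (bond_lattice (Gamma A))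
           = smult ((- 1) ^ card A) (\<Sum>k = c..card A. monom (s_D A k) (k - c))"
proof -
  let ?r = "bond_lattice (Gamma A)"
  let ?P = "bond_partitions (Gamma A)"
  have c_le: "c \<le> card \<pi>" if "\<pi> \<in> ?P" for \<pi>
    using components_bond_partition[OF \<open>finite A\<close>] that refines_card_le[OF \<open>finite A\<close>]
    unfolding c_def by metis
  have fin: "finite (D_perms A)" "finite ?P"
    using \<open>finite A\<close> by (auto simp: finite_D_perms finite_bond_partitions)
  have supp: "cycle_support A \<sigma> \<in> ?P" if "\<sigma> \<in> D_perms A" for \<sigma>
    using cycle_support_in_bond_partitions[OF that \<open>finite A\<close>] .
  have sgn: "sign \<sigma> = (- 1) ^ (card A + card (cycle_support A \<sigma>))" if "\<sigma> \<in> D_perms A" for \<sigma>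
    using sign_eq_card_cycle_support[OF \<open>finite A\<close>] that by (simp add: D_perms_def)
  have bot: "poset_bot ?r = singletons A"
    using Partial_order_bond_lattice[of "Gamma A"] \<open>finite A\<close>
    by (intro poset_bot_eqI)
      (auto simp: partial_order_on_def Field_bond_lattice singletons_in_bond_partitions singletons_bond_lattice)
  have "characteristic_poly ?r = (\<Sum>\<pi> \<in> ?P. monom (mobius ?r (singletons A) \<pi>) (card \<pi> - c))"
    unfolding characteristic_poly_def Field_bond_lattice bot
  proof (rule sum.cong[OF refl])
    fix \<pi> assume "\<pi> \<in> ?P"
    \<comment> \<open>The truncated subtractions are exact because \<open>c \<le> card \<pi>\<close>
      and \<open>card \<pi> \<le> card A\<close>; the two occurrences of \<open>card A\<close>
      cancel.\<close>
    then have "poset_length ?r - poset_rank ?r \<pi> = card \<pi> - c"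
      using c_le[of \<pi>] card_bond_partition_le[OF \<open>finite A\<close>, of \<pi>] \<open>finite A\<close>
      by (simp add: poset_rank_bond_lattice_Gamma poset_length_bond_lattice_Gamma c_def[symmetric])
    then show "monom (mobius ?r (singletons A) \<pi>) (poset_length ?r - poset_rank ?r \<pi>)
        = monom (mobius ?r (singletons A) \<pi>) (card \<pi> - c)"
      by simp
  qed
  also have "\<dots> = (\<Sum>\<pi> \<in> ?P. \<Sum>\<sigma> \<in> {\<sigma> \<in> D_perms A. cycle_support A \<sigma> = \<pi>}.
      monom (sign \<sigma>) (card (cycle_support A \<sigma>) - c))"
    using \<open>finite A\<close> by (intro sum.cong) (auto simp: mobius_bond_lattice_Gamma monom_sum)
  also have "\<dots> = (\<Sum>\<sigma> \<in> D_perms A. monom (sign \<sigma>) (card (cycle_support A \<sigma>) - c))"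
    using fin supp by (intro sum.group) auto
  \<comment> \<open>The sum is sorted again, now by the number of cycles. Cycle supports are bond
    partitions, so this number lies between \<open>c\<close> and \<open>card A\<close>.\<close>
  also have "\<dots> = (\<Sum>k = c..card A. \<Sum>\<sigma> \<in> {\<sigma> \<in> D_perms A. card (cycle_support A \<sigma>) = k}.
      monom (sign \<sigma>) (card (cycle_support A \<sigma>) - c))"
    using fin supp c_le card_bond_partition_le[OF \<open>finite A\<close>] by (intro sum.group[symmetric]) auto
  also have "\<dots> = (\<Sum>k = c..card A. smult ((- 1) ^ card A) (monom (s_D A k) (k - c)))"
  proof (rule sum.cong[OF refl])
    fix k
    have "(\<Sum>\<sigma> \<in> {\<sigma> \<in> D_perms A. card (cycle_support A \<sigma>) = k}. monom (sign \<sigma>) (card (cycle_support A \<sigma>) - c))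
        = (\<Sum>\<sigma> \<in> {\<sigma> \<in> D_perms A. card (cycle_support A \<sigma>) = k}. monom ((- 1) ^ (card A + k)) (k - c))"
      by (intro sum.cong) (auto simp: sgn)
    then show "(\<Sum>\<sigma> \<in> {\<sigma> \<in> D_perms A. card (cycle_support A \<sigma>) = k}. monom (sign \<sigma>) (card (cycle_support A \<sigma>) - c))
        = smult ((- 1) ^ card A) (monom (s_D A k) (k - c))"
      by (simp add: s_D_def smult_monom power_add of_nat_monom mult_monom mult_ac)
  qed
  also have "\<dots> = smult ((- 1) ^ card A) (\<Sum>k = c..card A. monom (s_D A k) (k - c))"
    using sum_comp_morphism[of "smult ((- 1) ^ card A)"] by (simp add: smult_add_right o_def)
  finally show ?thesis .
qed

text \<open>The factor \<open>(- 1) ^ card A\<close> cannot be dropped: for \<open>A = {1}\<close>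
  the Moebius value is 1 and the partition has one block, while the identity is the only
  D-permutation. The exponent \<open>k - 1\<close> needs a connected graph: for
  \<open>A = {1, 3}\<close> there are two components and the polynomial is 1, whereas
  \<open>k - 1\<close> would give \<open>t\<close>. The literal formulas therefore appear under
  parity and connectivity conditions, next to versions valid in general.\<close>

theorem theorem4p9:
  fixes A :: "nat set"
  assumes "finite A" and "0 \<notin> A"
  shows "(\<forall>\<pi> \<in> bond_partitions (Gamma A).
           (- 1) ^ card \<pi> * mobius (bond_lattice (Gamma A)) (singletons A) \<pi>
             = (- 1) ^ card A * int (card {\<sigma> \<in> D_perms A. cycle_support A \<sigma> = \<pi>}))
       \<and> (even (card A) \<longrightarrow>
           (\<forall>\<pi> \<in> bond_partitions (Gamma A).
              (- 1) ^ card \<pi> * mobius (bond_lattice (Gamma A)) (singletons A) \<pi>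
                = int (card {\<sigma> \<in> D_perms A. cycle_support A \<sigma> = \<pi>})))
       \<and> characteristic_poly (bond_lattice (Gamma A))
           = smult ((- 1) ^ card A)
               (\<Sum>k = num_components (Gamma A)..card A. monom (s_D A k) (k - num_components (Gamma A)))
       \<and> (even (card A) \<and> Digraph_Component.connected (Gamma A) \<longrightarrow>
           characteristic_poly (bond_lattice (Gamma A)) = (\<Sum>k = 1..card A. monom (s_D A k) (k - 1)))
       \<and> (\<forall>k. (- 1) ^ k * s_D A k = int (card {\<sigma> \<in> D_perms A. card (cycle_support A \<sigma>) = k}))"
proof -
  have mob: "(- 1) ^ card \<pi> * mobius (bond_lattice (Gamma A)) (singletons A) \<pi>
      = (- 1) ^ card A * int (card {\<sigma> \<in> D_perms A. cycle_support A \<sigma> = \<pi>})"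
    if "\<pi> \<in> bond_partitions (Gamma A)" for \<pi>
  proof -
    \<comment> \<open>The sign depends only on the number of cycles, so it is constant on the
      permutations with support \<open>\<pi>\<close> and the signed sum becomes a count.\<close>
    have "mobius (bond_lattice (Gamma A)) (singletons A) \<pi>
        = (\<Sum>\<sigma> \<in> {\<sigma> \<in> D_perms A. cycle_support A \<sigma> = \<pi>}. (- 1) ^ (card A + card \<pi>))"
      unfolding mobius_bond_lattice_Gamma[OF \<open>finite A\<close> that]
      using sign_eq_card_cycle_support[OF \<open>finite A\<close>] by (intro sum.cong) (auto simp: D_perms_def)
    then show ?thesis
      by (simp add: minus_one_power_iff)
  qed
  moreover have "num_components (Gamma A) = 1" if "Digraph_Component.connected (Gamma A)"
  proof -
    interpret sym_digraph "Gamma A"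
      by (rule sym_digraph_Gamma)
    have "sccs = {Gamma A}"
      using that by (simp add: connected_Gamma_iff strongly_connected_eq_iff)
    then show ?thesis
      by (simp add: num_components_def mk_symmetric_Gamma)
  qed
  moreover have "(- 1) ^ k * s_D A k = int (card {\<sigma> \<in> D_perms A. card (cycle_support A \<sigma>) = k})" for k
    by (simp add: s_D_def minus_one_power_iff)
  ultimately show ?thesis
    using characteristic_poly_bond_lattice_Gamma[OF \<open>finite A\<close>] by simp
qed

end
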